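(* Fix integers $d,m>1$ and let $p$ be a prime with $m\mid p^d-1$. Let $P$ be a polynomial with integer coefficients whose reduction modulo $p$ has degree $d$ and is irreducible over $\mathbb{F}_p$, let $\xi$ be a root of it, and let $F=\mathbb{F}_p(\xi)$, so that every element of $F$ can be written uniquely as $c_0+c_1\xi+\cdots+c_{d-1}\xi^{d-1}$ with $c_j\in\{0,1,\ldots,p-1\}$. Let \[R=[a_0,b_0]\times[a_1,b_1]\times\cdots\times[a_{d-1},b_{d-1}]\subset(0,p)^d\] be a box with real $a_j\le b_j$, and let $N$ be the number of elements $c_0+c_1\xi+\cdots+c_{d-1}\xi^{d-1}$ of $F$ that are $m$th powers in $F$ (i.e. equal to $y^m$ for some $y\in F$) and satisfy $(c_0,c_1,\ldots,c_{d-1})\in R$. Then \[\left|N-\frac{\prod_{j=0}^{d-1}\left(\lfloor b_j\rfloor-\lceil a_j\rceil+1\right)}{m}\right|\le\left[\frac{2}{\pi}\sqrt{p}\,\log(3p^d+1)\right]^d+\frac{2d}{m}\,p^{d/2}.\]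
   Context: $\mathbb{F}_p$ denotes the field with $p$ elements, and $\log$ denotes the natural logarithm. *)

theory Defs
  imports Complex_Main "HOL-Library.FuncSet" "Berlekamp_Zassenhaus.Finite_Field"
begin

definition is_subfield :: "'a::field set \<Rightarrow> bool" where
  "is_subfield K \<longleftrightarrow> 0 \<in> K \<and> 1 \<in> K \<and>
     (\<forall>x\<in>K. \<forall>y\<in>K. x - y \<in> K \<and> x * y \<in> K) \<and> (\<forall>x\<in>K. inverse x \<in> K)"

definition subfield_gen :: "'a::field set \<Rightarrow> 'a set" where
  "subfield_gen S = \<Inter> {K. is_subfield K \<and> S \<subseteq> K}"

text \<open>In a field of characteristic \<open>p\<close>, the image of the integers is the prime field
  \<open>\<F>\<^sub>p\<close>, so this is \<open>\<F>\<^sub>p(\<xi>)\<close>.\<close>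

definition prime_field_adjoin :: "'a::field \<Rightarrow> 'a set" where
  "prime_field_adjoin \<xi> = subfield_gen (insert \<xi> (range of_int))"

definition real_box :: "nat \<Rightarrow> (nat \<Rightarrow> real) \<Rightarrow> (nat \<Rightarrow> real) \<Rightarrow> (nat \<Rightarrow> real) set" where
  "real_box d a b = (\<Pi>\<^sub>E j\<in>{..<d}. {a j..b j})"

text \<open>Points of \<open>\<real>\<^sup>d\<close> are extensional functions on \<open>{..<d}\<close>. The integers \<open>c j\<close> are the
  canonical coordinates in \<open>{0..<p}\<close> of an element of \<open>\<F>\<^sub>p(\<xi>)\<close>.\<close>

definition power_count ::
    "nat \<Rightarrow> nat \<Rightarrow> nat \<Rightarrow> 'a::field \<Rightarrow> (nat \<Rightarrow> real) set \<Rightarrow> nat" where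
  "power_count p d m \<xi> R =
     card {x \<in> prime_field_adjoin \<xi>.
       (\<exists>y\<in>prime_field_adjoin \<xi>. x = y ^ m) \<and>
       (\<exists>c::nat \<Rightarrow> nat. (\<forall>j<d. c j < p) \<and> x = (\<Sum>j<d. of_nat (c j) * \<xi> ^ j) \<and>
          (\<lambda>j\<in>{..<d}. real (c j)) \<in> R)}"

end

theory Submission
  imports Defs "HOL-Analysis.Complex_Transcendental" "HOL-Analysis.Harmonic_Numbers"
begin

text \<open>Let \<open>q = p ^ d\<close>, let \<open>H\<close> be the group of nonzero \<open>m\<close>th powers, which has \<open>(q - 1) / m\<close> elements,
  and let \<open>f\<close> be the indicator function of \<open>H\<close> minus \<open>1 / m\<close> on the nonzero elements of the field, with
  \<open>f 0 = 0\<close>. The box avoids \<open>0\<close>, so the quantity to be bounded is the sum of \<open>f\<close> over the box.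

  No multiplicative characters are needed: since \<open>f\<close> is \<open>H\<close>-invariant, the sum of \<open>f x * \<psi> (h * x)\<close> over
  the field is the same for all \<open>h \<in> H\<close>, and Parseval's identity over all twists of a nontrivial additive
  character \<open>\<psi>\<close> bounds it by \<open>sqrt q\<close>. Expanding the indicator function of the box in additive characters,
  coordinate by coordinate, bounds the sum of \<open>f\<close> by \<open>sqrt q\<close> times a product of \<open>d\<close> normalised
  \<open>\<ell>\<^sup>1\<close> norms of Fourier transforms of intervals modulo \<open>p\<close>. Each of these is at most
  \<open>1 - 1 / p + ln p\<close> for odd \<open>p\<close> and at most \<open>1\<close> for \<open>p = 2\<close>, which is below \<open>2 / pi * ln (3 * p\<^sup>2 + 1)\<close>.
  The first error term alone therefore suffices.\<close>

section \<open>Coordinates in the field generated by a root\<close>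

text \<open>If \<open>P\<close> did not divide \<open>Q\<close>, a Bezout identity
  \<open>u * P + v * Q = 1\<close> would survive under \<open>h\<close> and read
  \<open>0 = 1\<close> at \<open>x\<close>. Thus \<open>P\<close> acts as the minimal polynomial of
  \<open>x\<close>.\<close>

lemma irreducible_dvd_of_common_root:
  fixes P Q :: "'k::field_gcd poly" and h :: "'k \<Rightarrow> 'f::field"
  assumes h: "field_hom h" and P: "irreducible P"
    and rP: "poly (map_poly h P) x = 0" and rQ: "poly (map_poly h Q) x = 0"
  shows "P dvd Q"
proof (rule ccontr)
  assume "\<not> P dvd Q"
  then have "gcd P Q = 1"
    using P by (metis coprime_iff_gcd_eq_1 irreducible_imp_prime_elem prime_elem_imp_coprime)
  then have "fst (bezout_coefficients P Q) * P + snd (bezout_coefficients P Q) * Q = 1"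
    by (simp add: bezout_coefficients_fst_snd)
  moreover interpret field_hom h by (rule h)
  interpret map_poly_comm_ring_hom h ..
  have "poly (map_poly h (u * P + v * Q)) x = 0" for u v
    by (simp add: hom_distribs rP rQ)
  ultimately have "poly (map_poly h 1) x = 0" by metis
  then show False by simp
qed

text \<open>The embedding of the prime field. Integer representatives respect sums and products only
  up to multiples of \<open>CARD('p)\<close>, and these vanish in the target.\<close>

lemma field_hom_of_int_mod_ring:
  assumes "CHAR('f::field) = CARD('p::prime_card)"
  shows "field_hom (\<lambda>c :: 'p mod_ring. of_int (to_int_mod_ring c) :: 'f)"
proof
  fix x y :: "'p mod_ring"
  show "of_int (to_int_mod_ring (x + y)) = (of_int (to_int_mod_ring x) + of_int (to_int_mod_ring y) :: 'f)"
    unfolding to_int_mod_ring_add assms[symmetric] by simp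
  show "of_int (to_int_mod_ring (x * y)) = (of_int (to_int_mod_ring x) * of_int (to_int_mod_ring y) :: 'f)"
    unfolding to_int_mod_ring_mult assms[symmetric] by simp
qed simp_all

lemma is_subfieldD:
  assumes "is_subfield K"
  shows "0 \<in> K" "1 \<in> K" "\<And>x y. x \<in> K \<Longrightarrow> y \<in> K \<Longrightarrow> x - y \<in> K"
    "\<And>x y. x \<in> K \<Longrightarrow> y \<in> K \<Longrightarrow> x + y \<in> K" "\<And>x y. x \<in> K \<Longrightarrow> y \<in> K \<Longrightarrow> x * y \<in> K"
    "\<And>x. x \<in> K \<Longrightarrow> inverse x \<in> K" "\<And>x n. x \<in> K \<Longrightarrow> x ^ n \<in> K"
proof -
  show *: "0 \<in> K" "1 \<in> K" "\<And>x y. x \<in> K \<Longrightarrow> y \<in> K \<Longrightarrow> x - y \<in> K"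
    "\<And>x y. x \<in> K \<Longrightarrow> y \<in> K \<Longrightarrow> x * y \<in> K" "\<And>x. x \<in> K \<Longrightarrow> inverse x \<in> K"
    using assms by (auto simp: is_subfield_def)
  show "x + y \<in> K" if "x \<in> K" "y \<in> K" for x y
    using *(3)[OF that(1) *(3)[OF *(1) that(2)]] by simp
  show "x ^ n \<in> K" if "x \<in> K" for x n
    using that * by (induction n) auto
qed

text \<open>On a finite \<open>K\<close>, multiplication by a nonzero \<open>x\<close> is injective,
  hence surjective, and so attains \<open>1\<close>.\<close>

lemma is_subfield_finite_subring:
  fixes K :: "'a::field set"
  assumes "finite K" "0 \<in> K" "1 \<in> K" "\<And>x y. x \<in> K \<Longrightarrow> y \<in> K \<Longrightarrow> x - y \<in> K"
    and mult: "\<And>x y. x \<in> K \<Longrightarrow> y \<in> K \<Longrightarrow> x * y \<in> K"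
  shows "is_subfield K"
proof -
  have "inverse x \<in> K" if x: "x \<in> K" for x
  proof (cases "x = 0")
    case False
    have "(*) x ` K = K"
      using False x mult by (intro endo_inj_surj[OF \<open>finite K\<close>]) (auto intro!: inj_onI)
    then obtain y where "y \<in> K" "x * y = 1"
      using \<open>1 \<in> K\<close> by (metis image_iff)
    then show ?thesis
      by (metis inverse_unique)
  qed (use assms in simp)
  then show ?thesis
    using assms by (auto simp: is_subfield_def)
qed

definition coord_elem :: "'a::comm_ring_1 \<Rightarrow> nat \<Rightarrow> (nat \<Rightarrow> nat) \<Rightarrow> 'a" where
  "coord_elem \<xi> d c = (\<Sum>j<d. of_nat (c j) * \<xi> ^ j)"

text \<open>The interface through which the later arguments see the field: the polynomial itself no
  longer appears, only the coordinates that it provides.\<close>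

locale finite_field_coords =
  fixes F :: "'f::field set" and \<xi> :: 'f and p d :: nat
  assumes subfield: "is_subfield F"
    and char: "CHAR('f) = p" and p_pos: "p > 0"
    and bij: "bij_betw (coord_elem \<xi> d) ({..<d} \<rightarrow>\<^sub>E {..<p}) F"

text \<open>Evaluation at \<open>\<xi>\<close> is a ring homomorphism on polynomials over
  \<open>'p mod_ring\<close> whose kernel consists of the multiples of \<open>Q\<close>. Remainders
  modulo \<open>Q\<close> therefore represent its values uniquely, which gives the coordinates. The
  range is a finite subring, hence a field, and it is the least one containing \<open>\<xi>\<close>
  and the integers.\<close>

lemma finite_field_coords_prime_field_adjoin:
  fixes P :: "int poly" and \<xi> :: "'f::field"
  assumes deg: "degree (map_poly of_int P :: 'p::prime_card mod_ring poly) = d"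
    and irr: "irreducible (map_poly of_int P :: 'p mod_ring poly)"
    and char: "CHAR('f) = CARD('p)"
    and root: "poly (map_poly of_int P) \<xi> = 0"
  shows "finite_field_coords (prime_field_adjoin \<xi>) \<xi> CARD('p) d"
proof -
  define h where "h = (\<lambda>c :: 'p mod_ring. of_int (to_int_mod_ring c) :: 'f)"
  define Q where "Q = (map_poly of_int P :: 'p mod_ring poly)"
  define ev where "ev = (\<lambda>f. poly (map_poly h f) \<xi>)"
  let ?C = "{..<d} \<rightarrow>\<^sub>E {..<CARD('p)}"
  have fh: "field_hom h"
    unfolding h_def by (rule field_hom_of_int_mod_ring[OF char])
  interpret h: field_hom h by (rule fh)
  interpret hp: map_poly_comm_ring_hom h ..
  have h_of_int: "h (of_int k) = of_int k" for k
    by (rule h.hom_of_int)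
  have "map_poly h Q = map_poly of_int P"
    unfolding Q_def by (subst map_poly_map_poly) (auto simp: o_def h_of_int)
  then have evQ: "ev Q = 0"
    using root by (simp add: ev_def)
  have Q: "degree Q = d" "irreducible Q" "Q \<noteq> 0"
    using deg irr by (auto simp: Q_def)
  have ev_dvd: "Q dvd f" if "ev f = 0" for f
    using irreducible_dvd_of_common_root[OF fh Q(2), of \<xi> f] that evQ by (simp add: ev_def)
  have ev_diff: "ev (f - g) = ev f - ev g" and ev_mult: "ev (f * g) = ev f * ev g"
    and ev_add: "ev (f + g) = ev f + ev g" and ev_0: "ev 0 = 0" and ev_1: "ev 1 = 1" for f g
    by (simp_all add: ev_def hom_distribs)
  have ev_mod: "ev (f mod Q) = ev f" for f
    by (metis ev_add ev_mult evQ mult_zero_right add_0 div_mult_mod_eq)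
  \<comment> \<open>A nonzero constant would be a unit. Positive degree is what makes the bound
    \<open>d - 1\<close> on \<open>degree (pol c)\<close> strictly smaller than
    \<open>d\<close>.\<close>
  have "degree Q \<noteq> 0"
  proof
    assume "degree Q = 0"
    then obtain c where "Q = [:c:]" by (rule degree_eq_zeroE)
    with Q(2,3) show False by (auto simp: irreducible_def is_unit_const_poly_iff dvd_field_iff)
  qed
  define pol where "pol c = (\<Sum>j<d. monom (of_nat (c j)) j :: 'p mod_ring poly)" for c
  have coeff_pol: "coeff (pol c) j = (if j < d then of_nat (c j) else 0)" for c j
    by (simp add: pol_def coeff_sum)
  have ev_pol: "ev (pol c) = coord_elem \<xi> d c" for c
  proof -
    have "map_poly h (pol c) = (\<Sum>j<d. monom (of_nat (c j)) j)"
      by (intro poly_eqI) (simp add: coeff_map_poly coeff_pol coeff_sum h.hom_of_nat)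
    then show ?thesis
      by (simp add: ev_def coord_elem_def poly_sum poly_monom)
  qed
  have deg_pol: "degree (pol c) < degree Q" for c
  proof -
    have "degree (pol c) \<le> d - 1"
      by (intro degree_le) (auto simp: coeff_pol)
    then show ?thesis using \<open>degree Q \<noteq> 0\<close> Q(1) by linarith
  qed
  have inj: "inj_on (coord_elem \<xi> d) ?C"
  proof (rule inj_onI)
    fix c c' assume c: "c \<in> ?C" "c' \<in> ?C" and eq: "coord_elem \<xi> d c = coord_elem \<xi> d c'"
    have "ev (pol c - pol c') = 0"
      using eq by (simp add: ev_diff ev_pol)
    then have "Q dvd pol c - pol c'" by (rule ev_dvd)
    moreover have "degree (pol c - pol c') < degree Q"
      by (intro degree_diff_less deg_pol)
    ultimately have "pol c = pol c'"
      by (metis dvd_imp_degree_le eq_iff_diff_eq_0 leD)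
    have "c j = c' j" if "j < d" for j
    proof -
      have "of_nat (c j) = (of_nat (c' j) :: 'p mod_ring)"
        using \<open>pol c = pol c'\<close> coeff_pol[of c j] coeff_pol[of c' j] that by simp
      then have "[c j = c' j] (mod CARD('p))"
        by (simp add: of_nat_eq_iff_cong_CHAR)
      then show ?thesis
        using c that by (auto simp: cong_def PiE_iff)
    qed
    then show "c = c'"
      using c by (intro PiE_ext) auto
  qed
  have img: "coord_elem \<xi> d ` ?C = range ev"
  proof (intro equalityI subsetI)
    fix x assume "x \<in> range ev"
    then obtain f where f: "x = ev f" by auto
    define g where "g = f mod Q"
    have dg: "degree g < d \<or> g = 0"
      using degree_mod_less[of Q f] Q by (auto simp: g_def)
    \<comment> \<open>The representatives below \<open>CARD('p)\<close> of the coefficients of the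
      remainder \<open>g\<close>.\<close>
    define c where "c = (\<lambda>j\<in>{..<d}. SOME i. i < CARD('p) \<and> coeff g j = of_nat i)"
    have c: "c j < CARD('p) \<and> coeff g j = of_nat (c j)" if "j < d" for j
      using someI_ex[OF surj_of_nat_mod_ring[of "coeff g j"]] that by (simp add: c_def)
    have "pol c = g"
      using c dg by (intro poly_eqI) (auto simp: coeff_pol coeff_eq_0)
    moreover have "c \<in> ?C" using c by (auto simp: c_def)
    moreover have "x = ev g" by (simp add: f g_def ev_mod)
    ultimately show "x \<in> coord_elem \<xi> d ` ?C"
      using ev_pol by blast
  next
    show "x \<in> range ev" if "x \<in> coord_elem \<xi> d ` ?C" for x
      using that by (auto simp flip: ev_pol)
  qed
  have sub: "is_subfield (range ev)"
  proof (rule is_subfield_finite_subring)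
    show "finite (range ev)"
      by (simp flip: img add: finite_PiE)
  qed (auto simp flip: ev_diff ev_mult ev_0 ev_1)
  have "prime_field_adjoin \<xi> = range ev"
  proof
    have "ev [:0, 1:] = \<xi>"
      by (simp add: ev_def)
    moreover have "ev (of_int k) = of_int k" for k
      by (simp add: ev_def hp.hom_of_int)
    ultimately have "insert \<xi> (range of_int) \<subseteq> range ev"
      by (metis image_subsetI insert_subset rangeI)
    then show "prime_field_adjoin \<xi> \<subseteq> range ev"
      using sub by (auto simp: prime_field_adjoin_def subfield_gen_def)
    show "range ev \<subseteq> prime_field_adjoin \<xi>"
      unfolding prime_field_adjoin_def subfield_gen_def
    proof (intro Inter_greatest)
      fix K assume "K \<in> {K. is_subfield K \<and> insert \<xi> (range of_int) \<subseteq> K}"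
      then have K: "is_subfield K" and "\<xi> \<in> K" and int: "of_int k \<in> K" for k by auto
      have "poly (map_poly h f) \<xi> \<in> K" for f
        using \<open>\<xi> \<in> K\<close> int
        by (induction f) (auto simp: hom_distribs h_def intro!: is_subfieldD[OF K])
      then show "range ev \<subseteq> K" by (auto simp: ev_def)
    qed
  qed
  then show ?thesis
    using sub inj img char by unfold_locales (auto simp: bij_betw_def)
qed

section \<open>Fourier transforms of intervals\<close>

text \<open>Jordan's inequality: sine is concave on \<open>{0..pi}\<close>, so up to
  \<open>pi / 2\<close> it lies above its chord.\<close>

lemma sin_ge_two_div_pi:
  assumes "0 \<le> x" "x \<le> pi / 2"
  shows "2 / pi * x \<le> sin x"
proof -
  have "convex_on {0..pi} (\<lambda>x. - sin x)"
  proof (rule f''_ge0_imp_convex)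
    show "((\<lambda>x. - sin x) has_real_derivative - cos x) (at x)" for x
      by (auto intro!: derivative_eq_intros)
    show "((\<lambda>x. - cos x) has_real_derivative sin x) (at x)" for x
      by (auto intro!: derivative_eq_intros)
    show "0 \<le> sin x" if "x \<in> {0..pi}" for x
      using that by (auto intro: sin_ge_zero)
  qed auto
  moreover have "0 \<le> 2 / pi * x" "2 / pi * x \<le> 1"
    using assms by (auto simp: field_simps)
  ultimately have "- sin ((1 - 2 / pi * x) *\<^sub>R 0 + (2 / pi * x) *\<^sub>R (pi / 2))
      \<le> (1 - 2 / pi * x) * - sin 0 + 2 / pi * x * - sin (pi / 2)"
    by (intro convex_onD) auto
  then show ?thesis by simp
qed

lemma norm_cis_diff_1: "norm (cis x - 1) = 2 * \<bar>sin (x / 2)\<bar>"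
  using dist_exp_i_1[of x] by (simp add: cis_conv_exp)

text \<open>Multiplying by \<open>z - 1\<close> makes the sum telescope to a difference of two
  numbers of norm 1.\<close>

lemma norm_sum_powers_le:
  fixes z :: complex
  assumes "norm z = 1" "z \<noteq> 1"
  shows "norm (\<Sum>c\<in>{l..<u::nat}. z ^ c) \<le> 2 / norm (z - 1)"
proof (cases "l \<le> u")
  case True
  have "(\<Sum>c\<in>{l..<u}. z ^ c) * (z - 1) = (\<Sum>c\<in>{l..<u}. z ^ Suc c - z ^ c)"
    by (subst sum_distrib_right) (simp add: algebra_simps)
  also have "\<dots> = z ^ u - z ^ l"
    by (rule sum_Suc_diff'[OF True])
  finally have "norm (\<Sum>c\<in>{l..<u}. z ^ c) * norm (z - 1) = norm (z ^ u - z ^ l)"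
    by (metis norm_mult)
  also have "\<dots> \<le> 2"
    using norm_triangle_ineq4[of "z ^ u" "z ^ l"] assms by (simp add: norm_power)
  finally show ?thesis
    using assms by (simp add: field_simps)
qed simp

text \<open>The bound is shaped to become \<open>ln p\<close> for \<open>p = 2 * n + 1\<close>. Each
  new term is at most the increment of the logarithm, because
  \<open>2 * x \<le> ln ((1 + x) / (1 - x))\<close> for \<open>x\<close> in
  \<open>[0, 1)\<close>.\<close>

lemma sum_inverse_le_ln: "(\<Sum>t=1..n. 1 / real t) \<le> ln (2 * real n + 1)"
proof (induction n)
  case (Suc n)
  have "1 / real (Suc n) \<le> ln (2 * real (Suc n) + 1) - ln (2 * real n + 1)"
  proof -
    \<comment> \<open>This choice makes \<open>2 * x\<close> the new term and
      \<open>(1 + x) / (1 - x)\<close> the ratio of the two arguments of the logarithm.\<close>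
    define x where "x = 1 / (2 * real n + 2)"
    have x: "0 < x" "x < 1" by (auto simp: x_def field_simps)
    have "2 * x \<le> ln ((1 + x) / (1 - x))"
    proof -
      define g :: "real \<Rightarrow> real" where "g = (\<lambda>y. ln (1 + y) - ln (1 - y) - 2 * y)"
      have "g 0 \<le> g x"
      proof (rule DERIV_nonneg_imp_nondecreasing[where f = g])
        fix y assume y: "0 \<le> y" "y \<le> x"
        then have "y * y < 1" using x mult_left_le[of y y] by linarith
        then have "(g has_real_derivative
              (1 / (1 + y) + 1 / (1 - y) - 2)) (at y)"
          unfolding g_def using y x by (auto intro!: derivative_eq_intros)
        moreover have "1 / (1 + y) + 1 / (1 - y) - 2 = 2 * (y * y) / (1 - y * y)"
          using y x \<open>y * y < 1\<close> by (simp add: divide_simps) (simp add: algebra_simps)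
        ultimately show "\<exists>D. (g has_real_derivative D) (at y) \<and> 0 \<le> D"
          using \<open>y * y < 1\<close> by (auto intro!: exI)
      qed (use x in auto)
      then show ?thesis using x by (simp add: g_def ln_div)
    qed
    also have "(1 + x) / (1 - x) = (2 * real (Suc n) + 1) / (2 * real n + 1)"
    proof -
      have "1 + x = (2 * real (Suc n) + 1) * x" "1 - x = (2 * real n + 1) * x"
        by (auto simp: x_def field_simps)
      then show ?thesis using x by simp
    qed
    also have "ln \<dots> = ln (2 * real (Suc n) + 1) - ln (2 * real n + 1)"
      by (simp add: ln_div)
    finally show ?thesis by (simp add: x_def field_simps)
  qed
  with Suc show ?case by simp
qed simp

text \<open>When the indicator function of \<open>{l..<u}\<close> is expanded in the characters of
  the integers modulo \<open>p\<close>, this is the sum of the absolute values of its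
  coefficients.\<close>

definition interval_dft_norm :: "nat \<Rightarrow> nat \<Rightarrow> nat \<Rightarrow> real" where
  "interval_dft_norm p l u =
     (\<Sum>t<p. norm (\<Sum>c\<in>{l..<u}. cis (2 * pi / real p) ^ (t * c))) / real p"

text \<open>For \<open>t \<le> p / 2\<close> Jordan's inequality gives
  \<open>norm (z - 1) = 2 * sin (pi * t / p) \<ge> 4 * t / p\<close> for the ratio \<open>z\<close>
  of the geometric sum. Frequency \<open>p - t\<close> has the conjugate ratio and hence the same
  bound.\<close>

lemma norm_interval_dft_le:
  assumes "0 < t" "2 * t \<le> p"
  shows "norm (\<Sum>c\<in>{l..<u}. cis (2 * pi / real p) ^ (t * c)) \<le> real p / (2 * real t)"
    and "norm (\<Sum>c\<in>{l..<u}. cis (2 * pi / real p) ^ ((p - t) * c)) \<le> real p / (2 * real t)"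
proof -
  define z where "z = cis (2 * (pi * real t / real p))"
  have "2 * real t / real p = 2 / pi * (pi * real t / real p)" by simp
  also have "\<dots> \<le> sin (pi * real t / real p)"
    using assms by (intro sin_ge_two_div_pi) (auto simp: field_simps simp flip: of_nat_mult)
  finally have ge: "4 * real t / real p \<le> norm (z - 1)"
    by (simp add: z_def norm_cis_diff_1)
  have pos: "0 < 4 * real t / real p" using assms by auto
  have z: "norm z = 1" "z \<noteq> 1"
    using ge pos by (auto simp: z_def)
  have "2 / norm (z - 1) \<le> 2 / (4 * real t / real p)"
    using ge pos by (intro divide_left_mono mult_pos_pos) linarith+
  also have "\<dots> = real p / (2 * real t)" by simp
  finally have le: "2 / norm (z - 1) \<le> real p / (2 * real t)" .
  have zt: "cis (2 * pi / real p) ^ t = z"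
    unfolding z_def Complex.DeMoivre by (simp add: mult.commute mult.left_commute)
  then show "norm (\<Sum>c\<in>{l..<u}. cis (2 * pi / real p) ^ (t * c)) \<le> real p / (2 * real t)"
    using norm_sum_powers_le[OF z, of l u] le by (simp add: power_mult)
  have "cis (2 * pi / real p) ^ p = 1"
    using assms by (simp add: Complex.DeMoivre)
  then have "cis (2 * pi / real p) ^ (p - t) * z = 1"
    using assms by (simp flip: zt power_add)
  then have "cis (2 * pi / real p) ^ (p - t) = cnj z"
    using z(1) complex_norm_square[of z] by (metis mult.assoc mult_1 mult_1_right of_real_1 one_power2)
  moreover have "norm (cnj z - 1) = norm (z - 1)"
    by (metis complex_cnj_diff complex_cnj_one complex_mod_cnj)
  moreover have "norm (cnj z) = 1" "cnj z \<noteq> 1"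
    using z by (auto simp: complex_cnj_cancel_iff[of z 1, simplified])
  ultimately show "norm (\<Sum>c\<in>{l..<u}. cis (2 * pi / real p) ^ ((p - t) * c)) \<le> real p / (2 * real t)"
    using norm_sum_powers_le[of "cnj z" l u] le by (simp add: power_mult)
qed

text \<open>Frequency 0 contributes the length of the interval. The others pair up as
  \<open>t\<close> and \<open>p - t\<close> with \<open>1 \<le> t \<le> n\<close>, and each pair
  contributes at most \<open>p / t\<close>, which leaves a harmonic sum.\<close>

lemma interval_dft_norm_odd_le:
  assumes p: "p = 2 * n + 1"
  shows "interval_dft_norm p l u \<le> real (u - l) / real p + ln (real p)"
proof -
  let ?D = "\<lambda>t. norm (\<Sum>c\<in>{l..<u}. cis (2 * pi / real p) ^ (t * c))"
  have split: "{..<p} = insert 0 ({1..n} \<union> (\<lambda>t. p - t) ` {1..n})"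
  proof (intro equalityI subsetI)
    fix t assume t: "t \<in> {..<p}"
    show "t \<in> insert 0 ({1..n} \<union> (\<lambda>t. p - t) ` {1..n})"
    proof (cases "t \<le> n")
      case False
      then have "t = p - (p - t)" "p - t \<in> {1..n}" using t p by auto
      then show ?thesis by blast
    qed auto
  qed (use p in auto)
  have "(\<Sum>t<p. ?D t) = ?D 0 + ((\<Sum>t=1..n. ?D t) + (\<Sum>t\<in>(\<lambda>t. p - t) ` {1..n}. ?D t))"
    unfolding split using p by (subst sum.insert; (subst sum.union_disjoint)?) auto
  also have "(\<Sum>t\<in>(\<lambda>t. p - t) ` {1..n}. ?D t) = (\<Sum>t=1..n. ?D (p - t))"
    using p by (subst sum.reindex) (auto intro!: inj_onI)
  also have "(\<Sum>t=1..n. ?D t) \<le> (\<Sum>t=1..n. real p / 2 * (1 / real t))"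
    using norm_interval_dft_le(1)[of _ p l u] p by (intro sum_mono) auto
  also have "(\<Sum>t=1..n. ?D (p - t)) \<le> (\<Sum>t=1..n. real p / 2 * (1 / real t))"
    using norm_interval_dft_le(2)[of _ p l u] p by (intro sum_mono) auto
  also have "(\<Sum>t=1..n. real p / 2 * (1 / real t)) = real p / 2 * (\<Sum>t=1..n. 1 / real t)"
    by (rule sum_distrib_left[symmetric])
  also have "?D 0 = real (u - l)" by simp
  finally have "(\<Sum>t<p. ?D t) \<le> real (u - l) + real p * (\<Sum>t=1..n. 1 / real t)"
    by simp
  also have "\<dots> \<le> real (u - l) + real p * ln (real p)"
    using sum_inverse_le_ln[of n] p by (intro add_left_mono mult_left_mono) (auto simp: add.commute)
  finally have "interval_dft_norm p l u \<le> (real (u - l) + real p * ln (real p)) / real p"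
    unfolding interval_dft_norm_def by (rule divide_right_mono) simp
  then show ?thesis
    using p by (simp only: add_divide_distrib) simp
qed

text \<open>Since \<open>d \<ge> 2\<close>, the logarithm on the right is at least
  \<open>ln 3 + 2 * ln p\<close>. With \<open>2 / pi \<ge> 0.6366\<close> it remains to compare
  numbers with \<open>0.6366 * ln 3 + 1.2732 * ln p\<close>.\<close>

lemma interval_dft_norm_prime_le:
  assumes p: "prime p" and d: "d > 1" and ul: "u - l < p"
  shows "interval_dft_norm p l u \<le> 2 / pi * ln (3 * real p ^ d + 1)"
proof -
  have p2: "p \<ge> 2" using p by (rule prime_ge_2_nat)
  have ln3: "1 \<le> ln (3::real)"
    using exp_le by (simp add: ln_ge_iff)
  have pi2: "6366 / 10000 \<le> 2 / pi"
    using pi_approx by (simp add: field_simps)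
  have "ln (3::real) + 2 * ln (real p) = ln (3 * real p ^ 2)"
    using p2 by (simp add: ln_mult ln_realpow)
  also have "\<dots> \<le> ln (3 * real p ^ d + 1)"
  proof (rule ln_mono)
    have "real p ^ 2 \<le> real p ^ d"
      using p2 d by (intro power_increasing) auto
    then show "3 * real p ^ 2 \<le> 3 * real p ^ d + 1" by linarith
  qed (use p2 in auto)
  finally have ln_ge: "ln 3 + 2 * ln (real p) \<le> ln (3 * real p ^ d + 1)" .
  have "6366 / 10000 * ln 3 + 12732 / 10000 * ln (real p) = 6366 / 10000 * (ln 3 + 2 * ln (real p))"
    by simp
  also have "\<dots> \<le> 2 / pi * ln (3 * real p ^ d + 1)"
    using p2 pi2 ln3 ln_ge by (intro mult_mono) auto
  finally have *: "6366 / 10000 * ln 3 + 12732 / 10000 * ln (real p) \<le> 2 / pi * ln (3 * real p ^ d + 1)" .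
  show ?thesis
  proof (cases "p = 2")
    \<comment> \<open>For \<open>p = 2\<close> the interval has at most one element, so every
      frequency contributes at most 1.\<close>
    case True
    have "norm (\<Sum>c\<in>{l..<u}. cis (2 * pi / real p) ^ (t * c)) \<le> 1" for t
    proof -
      have "norm (\<Sum>c\<in>{l..<u}. cis (2 * pi / real p) ^ (t * c)) \<le> (\<Sum>c\<in>{l..<u}. 1)"
        by (intro sum_norm_le) (simp add: norm_power)
      also have "\<dots> \<le> 1" using ul True by simp
      finally show ?thesis .
    qed
    then have "(\<Sum>t<p. norm (\<Sum>c\<in>{l..<u}. cis (2 * pi / real p) ^ (t * c))) \<le> (\<Sum>t<p. 1)"
      by (intro sum_mono)
    then have "interval_dft_norm p l u \<le> 1"
      using p2 by (simp add: interval_dft_norm_def)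
    also have "1 \<le> 6366 / 10000 * ln 3 + 12732 / 10000 * ln (real p)"
      using True ln2_ge_two_thirds ln3 by simp
    finally show ?thesis using * by simp
  next
    case False
    then have "odd p" using p p2 prime_odd_nat by force
    then obtain n where n: "p = 2 * n + 1" by (elim oddE)
    have "interval_dft_norm p l u \<le> real (u - l) / real p + ln (real p)"
      by (rule interval_dft_norm_odd_le[OF n])
    \<comment> \<open>One \<open>ln p\<close> has been spent on the harmonic sum. For
      \<open>p = 3\<close> the left side is at most \<open>2 / 3\<close>; from \<open>p = 4\<close>
      on, \<open>ln p \<ge> 2 * ln 2 \<ge> 4 / 3\<close> lifts the right side just above 1.\<close>
    also have "real (u - l) / real p \<le> 6366 / 10000 * ln 3 + 2732 / 10000 * ln (real p)"
    proof (cases "p = 3")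
      case True
      have "real (u - l) / real p \<le> 2 / 3" using ul True by simp
      then show ?thesis using True ln3 by simp
    next
      case False
      then have "4 \<le> p" using n p2 by presburger
      then have "ln (2 * 2 :: real) \<le> ln (real p)" by (subst ln_le_cancel_iff) auto
      then have "4 / 3 \<le> ln (real p)"
        using ln2_ge_two_thirds by (subst (asm) ln_mult) auto
      moreover have "real (u - l) / real p \<le> 1" using ul p2 by simp
      ultimately show ?thesis using ln3 by simp
    qed
    finally show ?thesis using * by simp
  qed
qed

section \<open>Additive character sums\<close>

definition additive_character :: "'a::field set \<Rightarrow> ('a \<Rightarrow> complex) \<Rightarrow> bool" where
  "additive_character F \<psi> \<longleftrightarrow>
     (\<forall>x\<in>F. norm (\<psi> x) = 1) \<and> (\<forall>x\<in>F. \<forall>y\<in>F. \<psi> (x + y) = \<psi> x * \<psi> y)"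

lemma bij_betw_subfield_mult:
  assumes F: "is_subfield F" and z: "z \<in> F" "z \<noteq> 0"
  shows "bij_betw ((*) z) F F"
  by (rule bij_betw_byWitness[where f' = "(*) (inverse z)"])
     (use z in \<open>auto intro!: is_subfieldD[OF F]\<close>)

text \<open>Translating by \<open>y\<close> multiplies the sum over \<open>F\<close> by
  \<open>\<psi> y\<close>, which is not 1; multiplication by \<open>z\<close> merely permutes
  \<open>F\<close>.\<close>

lemma sum_additive_character_eq_0:
  assumes F: "is_subfield F" and \<psi>: "additive_character F \<psi>" and y: "y \<in> F" "\<psi> y \<noteq> 1"
    and z: "z \<in> F" "z \<noteq> 0"
  shows "(\<Sum>a\<in>F. \<psi> (z * a)) = 0"
proof -
  have "bij_betw ((+) y) F F"
    by (rule bij_betw_byWitness[where f' = "\<lambda>x. x - y"])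
       (use y in \<open>auto intro!: is_subfieldD[OF F]\<close>)
  then have "(\<Sum>a\<in>F. \<psi> a) = (\<Sum>a\<in>F. \<psi> (y + a))"
    by (rule sum.reindex_bij_betw[symmetric])
  also have "\<dots> = (\<Sum>a\<in>F. \<psi> y * \<psi> a)"
    using \<psi> y by (intro sum.cong) (auto simp: additive_character_def)
  finally have "(1 - \<psi> y) * (\<Sum>a\<in>F. \<psi> a) = 0"
    by (simp only: sum_distrib_left[symmetric] left_diff_distrib) simp
  then have "(\<Sum>a\<in>F. \<psi> a) = 0"
    using y by simp
  then show ?thesis
    using sum.reindex_bij_betw[OF bij_betw_subfield_mult[OF F z], of \<psi>] by simp
qed

text \<open>Parseval's identity for the twists of \<open>\<psi>\<close>: after expanding the square,
  summing over \<open>a\<close> first leaves only the diagonal \<open>x' = x\<close>.\<close>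

lemma sum_norm_twisted_sums:
  assumes F: "is_subfield F" "finite F" and \<psi>: "additive_character F \<psi>" and y: "y \<in> F" "\<psi> y \<noteq> 1"
  shows "(\<Sum>a\<in>F. (norm (\<Sum>x\<in>F. f x * \<psi> (a * x)))\<^sup>2) = real (card F) * (\<Sum>x\<in>F. (norm (f x))\<^sup>2)"
proof -
  note F' = is_subfieldD[OF F(1)]
  have psi_0: "\<psi> 0 = 1"
    using \<psi> F'(1) by (auto simp: additive_character_def) (metis add_0 mult_cancel_right1 norm_zero zero_neq_one)
  have *: "\<psi> (a * x) * cnj (\<psi> (a * x')) = \<psi> ((x - x') * a)" if "a \<in> F" "x \<in> F" "x' \<in> F" for a x x'
  proof -
    have in_F: "(x - x') * a \<in> F" "a * x' \<in> F" using that by (auto intro!: F')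
    have "\<psi> (a * x) = \<psi> ((x - x') * a + a * x')" by (simp add: algebra_simps)
    also have "\<dots> = \<psi> ((x - x') * a) * \<psi> (a * x')"
      using \<psi> in_F by (auto simp: additive_character_def)
    finally show ?thesis
      using \<psi> in_F by (simp add: additive_character_def mult.assoc complex_norm_square[symmetric])
  qed
  have "complex_of_real (\<Sum>a\<in>F. (norm (\<Sum>x\<in>F. f x * \<psi> (a * x)))\<^sup>2)
      = (\<Sum>a\<in>F. (\<Sum>x\<in>F. f x * \<psi> (a * x)) * cnj (\<Sum>x\<in>F. f x * \<psi> (a * x)))"
    by (simp only: of_real_sum complex_norm_square)
  also have "\<dots> = (\<Sum>a\<in>F. \<Sum>x\<in>F. \<Sum>x'\<in>F. f x * cnj (f x') * \<psi> ((x - x') * a))"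
    by (intro sum.cong refl)
       (simp add: sum_product * mult.assoc mult.left_commute[of "\<psi> _"] cong: sum.cong)
  also have "\<dots> = (\<Sum>x\<in>F. \<Sum>a\<in>F. \<Sum>x'\<in>F. f x * cnj (f x') * \<psi> ((x - x') * a))"
    by (rule sum.swap)
  also have "\<dots> = (\<Sum>x\<in>F. \<Sum>x'\<in>F. \<Sum>a\<in>F. f x * cnj (f x') * \<psi> ((x - x') * a))"
    by (intro sum.cong refl sum.swap)
  also have "\<dots> = (\<Sum>x\<in>F. \<Sum>x'\<in>F. if x' = x then f x * cnj (f x) * of_nat (card F) else 0)"
  proof (intro sum.cong refl)
    fix x x' assume x: "x \<in> F" "x' \<in> F"
    show "(\<Sum>a\<in>F. f x * cnj (f x') * \<psi> ((x - x') * a))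
        = (if x' = x then f x * cnj (f x) * of_nat (card F) else 0)"
    proof (cases "x' = x")
      case False
      then have "(\<Sum>a\<in>F. \<psi> ((x - x') * a)) = 0"
        using x by (intro sum_additive_character_eq_0[OF F(1) \<psi> y] F') auto
      then show ?thesis using False by (simp flip: sum_distrib_left)
    qed (simp add: psi_0)
  qed
  also have "\<dots> = (\<Sum>x\<in>F. f x * cnj (f x) * of_nat (card F))"
    using F(2) by simp
  also have "\<dots> = complex_of_real (real (card F) * (\<Sum>x\<in>F. (norm (f x))\<^sup>2))"
    by (simp only: of_real_mult of_real_sum complex_norm_square sum_distrib_left of_real_of_nat_eq mult.commute)
  finally show ?thesis
    by (simp only: of_real_eq_iff)
qed

text \<open>This replaces the usual bound for Gauss sums: the twists of \<open>\<psi>\<close> by the elements of \<open>H\<close> all give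
  the same sum, so each of them carries at most the fraction \<open>1 / card H\<close> of the total mass.\<close>

lemma norm_character_sum_invariant_le:
  assumes F: "is_subfield F" "finite F" and \<psi>: "additive_character F \<psi>" and y: "y \<in> F" "\<psi> y \<noteq> 1"
    and H: "H \<subseteq> F - {0}" and inv: "\<And>h x. h \<in> H \<Longrightarrow> x \<in> F \<Longrightarrow> f (h * x) = f x"
  shows "real (card H) * (norm (\<Sum>x\<in>F. f x * \<psi> x))\<^sup>2 \<le> real (card F) * (\<Sum>x\<in>F. (norm (f x))\<^sup>2)"
proof -
  have "(\<Sum>x\<in>F. f x * \<psi> x) = (\<Sum>x\<in>F. f x * \<psi> (h * x))" if h: "h \<in> H" for h
  proof -
    have "(\<Sum>x\<in>F. f x * \<psi> x) = (\<Sum>x\<in>F. f (h * x) * \<psi> (h * x))"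
      using H h by (intro sum.reindex_bij_betw[symmetric] bij_betw_subfield_mult[OF F(1)]) auto
    then show ?thesis using inv[OF h] by simp
  qed
  then have "real (card H) * (norm (\<Sum>x\<in>F. f x * \<psi> x))\<^sup>2 = (\<Sum>a\<in>H. (norm (\<Sum>x\<in>F. f x * \<psi> (a * x)))\<^sup>2)"
    by (simp only: sum_constant[symmetric] cong: sum.cong)
  also have "\<dots> \<le> (\<Sum>a\<in>F. (norm (\<Sum>x\<in>F. f x * \<psi> (a * x)))\<^sup>2)"
    using H F(2) by (intro sum_mono2) auto
  also have "\<dots> = real (card F) * (\<Sum>x\<in>F. (norm (f x))\<^sup>2)"
    by (rule sum_norm_twisted_sums[OF F \<psi> y])
  finally show ?thesis .
qed

section \<open>The group of nonzero \<open>m\<close>th powers\<close>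

lemma card_nth_roots_le:
  fixes x :: "'a::idom"
  assumes "n > 0"
  shows "finite {y. y ^ n = x}" "card {y. y ^ n = x} \<le> n"
proof -
  let ?P = "monom 1 n - [:x:]"
  have "degree ?P = n"
    using assms degree_add_eq_left[of "- [:x:]" "monom 1 n"]
    by (simp only: diff_conv_add_uminus) (simp add: degree_monom_eq)
  moreover have "?P \<noteq> 0"
    using calculation assms by auto
  moreover have "{y. poly ?P y = 0} = {y. y ^ n = x}"
    by (auto simp: poly_monom)
  ultimately show "finite {y. y ^ n = x}" "card {y. y ^ n = x} \<le> n"
    using poly_roots_finite[of ?P] card_poly_roots_bound[of ?P] by auto
qed

lemma subfield_power_card_eq_1:
  assumes F: "is_subfield F" "finite F" and x: "x \<in> F" "x \<noteq> 0"
  shows "x ^ (card F - 1) = 1"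
proof -
  have "bij_betw ((*) x) (F - {0}) (F - {0})"
    by (rule bij_betw_byWitness[where f' = "(*) (inverse x)"])
       (use x in \<open>auto intro!: is_subfieldD[OF F(1)]\<close>)
  then have "(\<Prod>y\<in>F - {0}. y) = (\<Prod>y\<in>F - {0}. x * y)"
    by (rule prod.reindex_bij_betw[symmetric])
  also have "\<dots> = x ^ card (F - {0}) * (\<Prod>y\<in>F - {0}. y)"
    by (simp add: prod.distrib)
  finally have "x ^ card (F - {0}) = 1"
    using F(2) by simp
  then show ?thesis
    using F is_subfieldD(1)[OF F(1)] by simp
qed

definition nonzero_powers :: "'a::field set \<Rightarrow> nat \<Rightarrow> 'a set" where
  "nonzero_powers F m = (\<lambda>y. y ^ m) ` (F - {0})"

lemma nonzero_powers_subset: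
  assumes "is_subfield F"
  shows "nonzero_powers F m \<subseteq> F - {0}"
  using is_subfieldD(7)[OF assms] by (auto simp: nonzero_powers_def)

lemma nonzero_powers_mult_iff:
  assumes F: "is_subfield F" and h: "h \<in> nonzero_powers F m"
  shows "h * x \<in> nonzero_powers F m \<longleftrightarrow> x \<in> nonzero_powers F m"
proof -
  obtain z where z: "z \<in> F" "z \<noteq> 0" "h = z ^ m"
    using h by (auto simp: nonzero_powers_def)
  show ?thesis
  proof
    assume "h * x \<in> nonzero_powers F m"
    then obtain w where w: "w \<in> F" "w \<noteq> 0" "h * x = w ^ m"
      by (auto simp: nonzero_powers_def)
    then have "x = (inverse z * w) ^ m"
      using z by (simp add: power_mult_distrib field_simps)
    moreover have "inverse z * w \<in> F - {0}"
      using z w by (auto intro!: is_subfieldD[OF F])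
    ultimately show "x \<in> nonzero_powers F m"
      unfolding nonzero_powers_def by blast
  next
    assume "x \<in> nonzero_powers F m"
    then obtain w where w: "w \<in> F" "w \<noteq> 0" "x = w ^ m"
      by (auto simp: nonzero_powers_def)
    then have "h * x = (z * w) ^ m"
      using z by (simp add: power_mult_distrib)
    moreover have "z * w \<in> F - {0}"
      using z w by (auto intro!: is_subfieldD[OF F])
    ultimately show "h * x \<in> nonzero_powers F m"
      unfolding nonzero_powers_def by blast
  qed
qed

text \<open>Two opposite bounds: the fibres of \<open>y ^ m\<close> have at most \<open>m\<close>
  elements, so there are at least \<open>k = (card F - 1) / m\<close> powers; and all of them are
  roots of \<open>x ^ k = 1\<close>, so there are at most \<open>k\<close>.\<close>

lemma card_nonzero_powers:
  assumes F: "is_subfield F" "finite F" and m: "m dvd card F - 1"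
  shows "m * card (nonzero_powers F m) = card F - 1"
proof -
  let ?H = "nonzero_powers F m"
  have "card {0, 1 :: 'a} \<le> card F"
    using is_subfieldD(1,2)[OF F(1)] F(2) by (intro card_mono) auto
  then have q: "card F - 1 > 0" by simp
  then have "m > 0" using m by (auto intro: Nat.gr0I)
  obtain k where k: "card F - 1 = m * k" using m by (elim dvdE)
  then have "k > 0" using q by (auto intro: Nat.gr0I)
  have H: "finite ?H" using F by (simp add: nonzero_powers_def)
  have "card (F - {0}) \<le> card (\<Union>x\<in>?H. {y. y ^ m = x})"
    using H card_nth_roots_le(1)[OF \<open>m > 0\<close>]
    by (intro card_mono finite_UN_I) (auto simp: nonzero_powers_def)
  also have "\<dots> \<le> (\<Sum>x\<in>?H. card {y. y ^ m = x})"
    by (rule card_UN_le[OF H])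
  also have "\<dots> \<le> (\<Sum>x\<in>?H. m)"
    using card_nth_roots_le(2)[OF \<open>m > 0\<close>] by (intro sum_mono)
  finally have "card F - 1 \<le> m * card ?H"
    using F is_subfieldD(1)[OF F(1)] by (simp add: mult.commute)
  moreover have "?H \<subseteq> {x. x ^ k = 1}"
    using subfield_power_card_eq_1[OF F, unfolded k]
    by (auto simp: nonzero_powers_def simp flip: power_mult)
  then have "card ?H \<le> k"
    using card_nth_roots_le[OF \<open>k > 0\<close>, of 1] card_mono le_trans by blast
  ultimately show ?thesis
    using k \<open>m > 0\<close> by (simp add: le_antisym)
qed

text \<open>The density of \<open>nonzero_powers F m\<close> among the nonzero elements is
  \<open>1 / m\<close> when \<open>m\<close> divides \<open>card F - 1\<close>, so with the value 0
  at 0 the sum over \<open>F\<close> vanishes and the trivial character needs no main term.\<close>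

definition power_deviation :: "'a::field set \<Rightarrow> nat \<Rightarrow> 'a \<Rightarrow> real" where
  "power_deviation F m x = (if x = 0 then 0 else of_bool (x \<in> nonzero_powers F m) - 1 / real m)"

text \<open>For nontrivial \<open>\<psi>\<close> the squares of the deviation sum to
  \<open>card H * (1 - 1 / m)\<close>, with \<open>H\<close> the group of nonzero powers, so
  \<open>card H\<close> cancels in the bound for invariant functions. For trivial
  \<open>\<psi>\<close> the sum is 0.\<close>

lemma norm_power_deviation_character_sum_le:
  assumes F: "is_subfield F" "finite F" and m: "m dvd card F - 1" "m > 0"
    and \<psi>: "additive_character F \<psi>"
  shows "norm (\<Sum>x\<in>F. complex_of_real (power_deviation F m x) * \<psi> x) \<le> sqrt (real (card F))"
proof -
  let ?H = "nonzero_powers F m" and ?f = "power_deviation F m"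
  have HF: "?H \<subseteq> F - {0}" by (rule nonzero_powers_subset[OF F(1)])
  have zero: "0 \<in> F" using is_subfieldD(1)[OF F(1)] .
  have cH: "real m * real (card ?H) = real (card (F - {0}))"
    using card_nonzero_powers[OF F m(1)] F zero by (simp flip: of_nat_mult)
  have "card (F - {0}) > 0"
    using is_subfieldD(2)[OF F(1)] F(2) by (auto simp: card_gt_0_iff)
  then have H_pos: "card ?H > 0" using cH by (intro Nat.gr0I) auto
  have sum_of_bool: "(\<Sum>x\<in>F - {0}. of_bool (x \<in> ?H)) = real (card ?H)"
    using HF F(2) by (simp add: Int_absorb1 flip: Int_def Collect_mem_eq)
  have sum_f: "(\<Sum>x\<in>F. g (?f x)) = (\<Sum>x\<in>F - {0}. g (of_bool (x \<in> ?H) - 1 / real m))"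
    if "g 0 = 0" for g :: "real \<Rightarrow> real"
    using F(2) zero that by (subst sum.remove[of _ 0]) (auto simp: power_deviation_def intro!: sum.cong)
  show ?thesis
  proof (cases "\<exists>y\<in>F. \<psi> y \<noteq> 1")
    case True
    then obtain y where y: "y \<in> F" "\<psi> y \<noteq> 1" by blast
    have inv: "complex_of_real (?f (h * x)) = complex_of_real (?f x)" if "h \<in> ?H" "x \<in> F" for h x
      using that HF nonzero_powers_mult_iff[OF F(1) that(1)] by (auto simp: power_deviation_def)
    \<comment> \<open>The indicator equals its own square, so the squared deviation is affine in
      it.\<close>
    have "(\<Sum>x\<in>F. (?f x)\<^sup>2) = (\<Sum>x\<in>F - {0}. (1 - 2 / real m) * of_bool (x \<in> ?H) + (1 / real m)\<^sup>2)"
      unfolding sum_f[of "\<lambda>x. x\<^sup>2", simplified]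
      by (intro sum.cong) (auto simp: power2_eq_square algebra_simps)
    also have "\<dots> = (1 - 2 / real m) * real (card ?H) + real m * real (card ?H) * (1 / real m)\<^sup>2"
      by (simp only: sum.distrib sum_distrib_left[symmetric] sum_of_bool sum_constant cH)
    also have "\<dots> = real (card ?H) * (1 - 1 / real m)"
      using m(2) by (simp add: field_simps power2_eq_square)
    also have "\<dots> \<le> real (card ?H)"
      by (simp add: mult_left_le)
    finally have "(\<Sum>x\<in>F. (?f x)\<^sup>2) \<le> real (card ?H)" .
    then have "real (card F) * (\<Sum>x\<in>F. (norm (complex_of_real (?f x)))\<^sup>2) \<le> real (card F) * real (card ?H)"
      by (intro mult_left_mono) auto
    then have "real (card ?H) * (norm (\<Sum>x\<in>F. complex_of_real (?f x) * \<psi> x))\<^sup>2 \<le> real (card F) * real (card ?H)"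
      using norm_character_sum_invariant_le[OF F \<psi> y HF inv] by linarith
    then show ?thesis
      using H_pos by (intro real_le_rsqrt) (simp add: mult.commute)
  next
    case False
    then have "(\<Sum>x\<in>F. complex_of_real (?f x) * \<psi> x) = complex_of_real (\<Sum>x\<in>F. ?f x)"
      by simp
    also have "(\<Sum>x\<in>F. ?f x) = 0"
    proof -
      have "(\<Sum>x\<in>F. ?f x) = (\<Sum>x\<in>F - {0}. of_bool (x \<in> ?H)) - (\<Sum>x\<in>F - {0}. 1 / real m)"
        using sum_f[of "\<lambda>x. x"] by (simp only: sum_subtractf)
      also have "\<dots> = real (card ?H) - real m * real (card ?H) * (1 / real m)"
        by (simp only: sum_of_bool sum_constant cH)
      finally show ?thesis using m(2) by simp
    qed
    finally show ?thesis by simp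
  qed
qed

section \<open>Expanding boxes in additive characters\<close>

lemma sum_roots_of_unity_delta:
  fixes p :: nat
  defines "\<omega> \<equiv> cis (2 * pi / real p)"
  assumes "c < p" "k < p"
  shows "(\<Sum>t<p. cnj \<omega> ^ (t * k) * \<omega> ^ (t * c)) = (if k = c then of_nat p else 0)"
proof -
  define z where "z = cnj \<omega> ^ k * \<omega> ^ c"
  have unit: "cnj \<omega> * \<omega> = 1" "\<omega> * cnj \<omega> = 1"
    by (simp_all add: \<omega>_def cis_cnj cis_mult)
  have "\<omega> ^ p = 1"
    using assms by (simp add: \<omega>_def Complex.DeMoivre)
  moreover from this have "cnj \<omega> ^ p = 1"
    by (metis complex_cnj_one complex_cnj_power)
  ultimately have "z ^ p = 1"
    by (simp add: z_def power_mult_distrib flip: power_mult) (simp add: mult.commute[of _ p] power_mult)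
  have eq: "(\<Sum>t<p. cnj \<omega> ^ (t * k) * \<omega> ^ (t * c)) = (\<Sum>t<p. z ^ t)"
    by (simp add: z_def power_mult_distrib mult.commute flip: power_mult)
  show ?thesis
  proof (cases "k = c")
    case True
    then have "z = 1" by (simp add: z_def unit flip: power_mult_distrib)
    then show ?thesis using True eq by simp
  next
    case False
    have "z \<noteq> 1"
    proof
      assume "z = 1"
      have "\<omega> ^ k = \<omega> ^ k * z" by (simp add: \<open>z = 1\<close>)
      also have "\<dots> = (\<omega> * cnj \<omega>) ^ k * \<omega> ^ c" by (simp add: z_def power_mult_distrib mult.assoc)
      finally have "\<omega> ^ k = \<omega> ^ c" by (simp add: unit)
      then have "cis (2 * pi * real k / real p) = cis (2 * pi * real c / real p)"
        by (simp add: \<omega>_def Complex.DeMoivre mult_ac)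
      then show False
        using Complex.bij_betw_roots_unity[of p] assms False by (auto simp: bij_betw_def inj_on_def)
    qed
    moreover have "(z - 1) * (\<Sum>t<p. z ^ t) = 0"
      using power_diff_1_eq[of z p] \<open>z ^ p = 1\<close> by simp
    ultimately show ?thesis using False eq by simp
  qed
qed

context finite_field_coords
begin

abbreviation "coords \<equiv> {..<d} \<rightarrow>\<^sub>E {..<p}"

lemma finite_F: "finite F"
  using bij_betw_finite[OF bij] by (simp add: finite_PiE)

lemma card_F: "card F = p ^ d"
  using bij_betw_same_card[OF bij] by (simp add: card_PiE)

text \<open>Every frequency vector \<open>t\<close> yields a character. Adding field elements adds
  coordinates modulo \<open>p\<close> without carries, and \<open>p\<close>th roots of unity do not
  see the reduction.\<close>

lemma additive_character_coords:
  fixes t :: "nat \<Rightarrow> nat"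
  defines "\<psi> \<equiv> (\<lambda>x. \<Prod>j<d. cis (2 * pi / real p) ^ (t j * inv_into coords (coord_elem \<xi> d) x j))"
  shows "additive_character F \<psi>"
    and "c \<in> coords \<Longrightarrow> \<psi> (coord_elem \<xi> d c) = (\<Prod>j<d. cis (2 * pi / real p) ^ (t j * c j))"
proof -
  let ?\<omega> = "cis (2 * pi / real p)" and ?\<phi> = "coord_elem \<xi> d"
  show *: "\<psi> (?\<phi> c) = (\<Prod>j<d. ?\<omega> ^ (t j * c j))" if "c \<in> coords" for c
    using that bij by (simp add: \<psi>_def bij_betw_inv_into_left)
  have "?\<omega> ^ p = 1"
    using p_pos by (simp add: Complex.DeMoivre)
  then have mod: "?\<omega> ^ (s * (n mod p)) = ?\<omega> ^ (s * n)" for s n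
  proof -
    have "?\<omega> ^ (s * n) = ?\<omega> ^ (s * (n mod p) + p * (s * (n div p)))"
      by (metis add.commute distrib_left mult.left_commute mult_div_mod_eq)
    then show ?thesis using \<open>?\<omega> ^ p = 1\<close> by (simp add: power_add power_mult)
  qed
  show "additive_character F \<psi>"
    unfolding additive_character_def
  proof (intro conjI ballI)
    show "norm (\<psi> x) = 1" for x
      by (simp add: \<psi>_def prod_norm[symmetric] norm_power)
    fix x y assume "x \<in> F" "y \<in> F"
    then have "x \<in> ?\<phi> ` coords" "y \<in> ?\<phi> ` coords"
      by (simp_all add: bij_betw_imp_surj_on[OF bij])
    then obtain c c' where c: "c \<in> coords" "x = ?\<phi> c" and c': "c' \<in> coords" "y = ?\<phi> c'"
      by (elim imageE) (rule that)
    define e where "e = (\<lambda>j\<in>{..<d}. (c j + c' j) mod p)"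
    have e: "e \<in> coords" using p_pos by (auto simp: e_def)
    have "x + y = ?\<phi> e"
      using of_nat_mod_CHAR[where 'a = 'f]
      by (simp add: c c' coord_elem_def e_def char flip: sum.distrib distrib_right)
    then have "\<psi> (x + y) = (\<Prod>j<d. ?\<omega> ^ (t j * (c j + c' j)))"
      using *[OF e] by (simp add: e_def mod)
    also have "\<dots> = \<psi> x * \<psi> y"
      using *[OF c(1)] *[OF c'(1)] c c' by (simp add: distrib_left power_add prod.distrib)
    finally show "\<psi> (x + y) = \<psi> x * \<psi> y" .
  qed
qed

text \<open>The indicator function of the box is a product of one-dimensional ones, hence a
  combination of characters whose coefficients are products. The triangle inequality bounds each
  character sum by \<open>M\<close>, and the sum of the absolute values of the coefficients
  factorises over the coordinates.\<close>

lemma norm_sum_box_le: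
  fixes f :: "'f \<Rightarrow> complex"
  assumes M: "\<And>\<psi>. additive_character F \<psi> \<Longrightarrow> norm (\<Sum>x\<in>F. f x * \<psi> x) \<le> M"
    and u: "\<And>j. j < d \<Longrightarrow> u j \<le> p"
  shows "norm (\<Sum>x\<in>coord_elem \<xi> d ` (\<Pi>\<^sub>E j\<in>{..<d}. {l j..<u j}). f x)
      \<le> M * (\<Prod>j<d. interval_dft_norm p (l j) (u j))"
proof -
  let ?\<omega> = "cis (2 * pi / real p)" and ?\<phi> = "coord_elem \<xi> d"
  let ?B = "\<Pi>\<^sub>E j\<in>{..<d}. {l j..<u j}"
  \<comment> \<open>The Fourier coefficients of the indicator function of
    \<open>{l j..<u j}\<close>, so that \<open>A j t\<close> multiplies the character of frequency
    \<open>t\<close>.\<close>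
  define A where "A j t = (\<Sum>k\<in>{l j..<u j}. cnj ?\<omega> ^ (t * k)) / of_nat p" for j t
  have B: "?B \<subseteq> coords" using u by (intro PiE_mono) force
  have A: "(\<Sum>t<p. A j t * ?\<omega> ^ (t * c)) = of_bool (c \<in> {l j..<u j})" if "j < d" "c < p" for j c
  proof -
    have "(\<Sum>t<p. A j t * ?\<omega> ^ (t * c))
        = (\<Sum>t<p. \<Sum>k\<in>{l j..<u j}. cnj ?\<omega> ^ (t * k) * ?\<omega> ^ (t * c)) / of_nat p"
      by (simp add: A_def sum_divide_distrib sum_distrib_right)
    also have "\<dots> = (\<Sum>k\<in>{l j..<u j}. \<Sum>t<p. cnj ?\<omega> ^ (t * k) * ?\<omega> ^ (t * c)) / of_nat p"
      by (subst sum.swap) (rule refl)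
    also have "\<dots> = (\<Sum>k\<in>{l j..<u j}. if k = c then of_nat p else 0) / of_nat p"
      using u[OF that(1)] that(2) by (intro arg_cong2[where f = "(/)"] sum.cong sum_roots_of_unity_delta refl) auto
    also have "\<dots> = of_bool (c \<in> {l j..<u j})"
      using p_pos by simp
    finally show ?thesis .
  qed
  have ind: "of_bool (c \<in> ?B) = (\<Sum>t\<in>coords. (\<Prod>j<d. A j (t j)) * (\<Prod>j<d. ?\<omega> ^ (t j * c j)))"
    if c: "c \<in> coords" for c
  proof -
    have "of_bool (c \<in> ?B) = (\<Prod>j<d. of_bool (c j \<in> {l j..<u j}) :: complex)"
      using c by (cases "c \<in> ?B") (auto simp: PiE_iff prod_zero_iff)
    also have "\<dots> = (\<Prod>j<d. \<Sum>t<p. A j t * ?\<omega> ^ (t * c j))"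
      using c A by (intro prod.cong) (auto simp: PiE_iff)
    also have "\<dots> = (\<Sum>t\<in>coords. \<Prod>j<d. A j (t j) * ?\<omega> ^ (t j * c j))"
      by (rule prod_sum_PiE) auto
    finally show ?thesis by (simp add: prod.distrib)
  qed
  have fin: "finite coords" by (simp add: finite_PiE)
  have char_sum: "norm (\<Sum>c\<in>coords. f (?\<phi> c) * (\<Prod>j<d. ?\<omega> ^ (t j * c j))) \<le> M" for t
  proof -
    define \<psi> where "\<psi> = (\<lambda>x. \<Prod>j<d. cis (2 * pi / real p) ^ (t j * inv_into coords (coord_elem \<xi> d) x j))"
    have "(\<Sum>x\<in>F. f x * \<psi> x) = (\<Sum>c\<in>coords. f (?\<phi> c) * \<psi> (?\<phi> c))"
      by (rule sum.reindex_bij_betw[OF bij, symmetric])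
    also have "\<dots> = (\<Sum>c\<in>coords. f (?\<phi> c) * (\<Prod>j<d. ?\<omega> ^ (t j * c j)))"
      unfolding \<psi>_def by (intro sum.cong refl) (simp add: additive_character_coords(2))
    finally show ?thesis
      using M[OF additive_character_coords(1)[of t]] by (simp add: \<psi>_def)
  qed
  have "(\<Sum>x\<in>?\<phi> ` ?B. f x) = (\<Sum>c\<in>?B. f (?\<phi> c))"
    using B bij by (subst sum.reindex) (auto simp: bij_betw_def intro: inj_on_subset)
  also have "\<dots> = (\<Sum>c\<in>coords. f (?\<phi> c) * of_bool (c \<in> ?B))"
    using B fin by (intro sum.mono_neutral_cong_left) auto
  also have "\<dots> = (\<Sum>c\<in>coords. \<Sum>t\<in>coords. (\<Prod>j<d. A j (t j)) * (f (?\<phi> c) * (\<Prod>j<d. ?\<omega> ^ (t j * c j))))"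
    by (intro sum.cong refl, subst ind) (auto simp: sum_distrib_left mult_ac)
  also have "\<dots> = (\<Sum>t\<in>coords. (\<Prod>j<d. A j (t j)) * (\<Sum>c\<in>coords. f (?\<phi> c) * (\<Prod>j<d. ?\<omega> ^ (t j * c j))))"
    by (subst sum.swap) (simp add: sum_distrib_left)
  finally have "norm (\<Sum>x\<in>?\<phi> ` ?B. f x) = norm \<dots>" by simp
  also have "\<dots> \<le> (\<Sum>t\<in>coords. (\<Prod>j<d. norm (A j (t j))) * M)"
    using char_sum by (intro sum_norm_le) (auto simp: norm_mult prod_norm intro!: mult_left_mono prod_nonneg)
  \<comment> \<open>Distributivity read backwards turns the sum over frequency vectors into a
    product of one-dimensional sums.\<close>
  also have "\<dots> = M * (\<Prod>j<d. \<Sum>t<p. norm (A j t))"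
    by (subst prod_sum_PiE) (auto simp: sum_distrib_left mult.commute)
  also have "(\<Prod>j<d. \<Sum>t<p. norm (A j t)) = (\<Prod>j<d. interval_dft_norm p (l j) (u j))"
  proof (intro prod.cong refl)
    fix j
    have "norm (A j t) = norm (\<Sum>k\<in>{l j..<u j}. ?\<omega> ^ (t * k)) / real p" for t
    proof -
      have "(\<Sum>k\<in>{l j..<u j}. cnj ?\<omega> ^ (t * k)) = cnj (\<Sum>k\<in>{l j..<u j}. ?\<omega> ^ (t * k))"
        by simp
      then show ?thesis by (simp only: A_def norm_divide complex_mod_cnj norm_of_nat)
    qed
    then show "(\<Sum>t<p. norm (A j t)) = interval_dft_norm p (l j) (u j)"
      by (simp add: interval_dft_norm_def sum_divide_distrib)
  qed
  finally show ?thesis .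
qed

end

section \<open>Counting powers in the box\<close>

theorem theorem3:
  fixes d m p :: nat
    and P :: "int poly"
    and \<xi> :: "'f::field"
    and a b :: "nat \<Rightarrow> real"
  assumes "d > 1" and "m > 1"
    and "p = CARD('p::prime_card)"
    and "m dvd p ^ d - 1"
    and "degree (map_poly of_int P :: 'p mod_ring poly) = d"
    and "irreducible (map_poly of_int P :: 'p mod_ring poly)"
    and "CHAR('f) = p"
    and "poly (map_poly of_int P) \<xi> = 0"
    and "\<And>j. j < d \<Longrightarrow> a j \<le> b j"
    and "real_box d a b \<subseteq> (\<Pi>\<^sub>E j\<in>{..<d}. {0<..<real p})"
  shows "\<bar>real (power_count p d m \<xi> (real_box d a b))
            - (\<Prod>j<d. real_of_int (\<lfloor>b j\<rfloor> - \<lceil>a j\<rceil> + 1)) / real m\<bar>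
         \<le> (2 / pi * sqrt (real p) * ln (3 * real p ^ d + 1)) ^ d
            + 2 * real d / real m * real p powr (real d / 2)"
proof -
  define F where "F = prime_field_adjoin \<xi>"
  interpret finite_field_coords F \<xi> p d
    unfolding F_def \<open>p = CARD('p)\<close>
    using finite_field_coords_prime_field_adjoin[where 'p = 'p] assms by blast
  have p: "prime p" using assms(3) prime_card[where 'a = 'p] by simp
  let ?\<phi> = "coord_elem \<xi> d" and ?H = "nonzero_powers F m"
  have ab: "0 < a j" "b j < real p" if "j < d" for j
  proof -
    \<comment> \<open>The two extreme corners belong to the box, so the inclusion constrains
      \<open>a\<close> and \<open>b\<close> themselves.\<close>
    have "restrict a {..<d} \<in> real_box d a b" "restrict b {..<d} \<in> real_box d a b"
      using assms(9) by (auto simp: real_box_def)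
    then have "restrict a {..<d} j \<in> {0<..<real p}" "restrict b {..<d} j \<in> {0<..<real p}"
      using assms(10) that by blast+
    then show "0 < a j" "b j < real p" using that by auto
  qed
  \<comment> \<open>Half-open intervals holding exactly the integers of \<open>{a j..b j}\<close>.
    As \<open>a j \<le> b j\<close> forces
    \<open>\<lceil>a j\<rceil> \<le> \<lfloor>b j\<rfloor> + 1\<close>, the truncated difference
    \<open>u j - l j\<close> is the exact length, also when it is 0.\<close>
  define l u where "l j = nat \<lceil>a j\<rceil>" and "u j = nat (\<lfloor>b j\<rfloor> + 1)" for j
  have l_pos: "0 < l j" and u_le: "u j \<le> p" and mem: "c \<in> {l j..<u j} \<longleftrightarrow> real c \<in> {a j..b j}"
    and ul: "real (u j - l j) = real_of_int (\<lfloor>b j\<rfloor> - \<lceil>a j\<rceil> + 1)" if "j < d" for j c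
  proof -
    have *: "0 < a j" "b j < real p" "a j \<le> b j" using ab assms(9) that by auto
    show "0 < l j" using * by (simp add: l_def)
    show "u j \<le> p" using * by (simp add: u_def) linarith
    show "c \<in> {l j..<u j} \<longleftrightarrow> real c \<in> {a j..b j}"
      using * by (auto simp: l_def u_def) linarith+
    show "real (u j - l j) = real_of_int (\<lfloor>b j\<rfloor> - \<lceil>a j\<rceil> + 1)"
      using * by (simp add: l_def u_def) linarith
  qed
  define B where "B = (\<Pi>\<^sub>E j\<in>{..<d}. {l j..<u j})"
  have B: "B \<subseteq> coords" unfolding B_def using u_le by (intro PiE_mono) force
  have inj: "inj_on ?\<phi> coords" using bij by (simp add: bij_betw_def)
  have \<phi>B: "?\<phi> ` B \<subseteq> F - {0}"
  proof -
    \<comment> \<open>The element 0 has only zero coordinates, whereas coordinate 0 of a point of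
      \<open>B\<close> is at least \<open>l 0 > 0\<close>.\<close>
    have "?\<phi> c \<noteq> 0" if "c \<in> B" for c
    proof
      assume "?\<phi> c = 0"
      then have "?\<phi> c = ?\<phi> (\<lambda>j\<in>{..<d}. 0)" by (simp add: coord_elem_def)
      moreover have "(\<lambda>j\<in>{..<d}. 0) \<in> coords" using p_pos by auto
      ultimately have "c = (\<lambda>j\<in>{..<d}. 0)" using that B by (intro inj_onD[OF inj]) auto
      then have "c 0 = 0" using \<open>d > 1\<close> by simp
      moreover have "c 0 \<in> {l 0..<u 0}" using that \<open>d > 1\<close> PiE_mem[of c "{..<d}" "\<lambda>j. {l j..<u j}" 0]
        unfolding B_def by simp
      ultimately show False using l_pos[of 0] \<open>d > 1\<close> by simp
    qed
    then show ?thesis using B bij by (auto simp: bij_betw_def)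
  qed
  have finB: "finite B" unfolding B_def by (simp add: finite_PiE)
  have count: "power_count p d m \<xi> (real_box d a b) = card (?\<phi> ` B \<inter> ?H)"
  proof -
    have box: "(\<exists>c. (\<forall>j<d. c j < p) \<and> x = (\<Sum>j<d. of_nat (c j) * \<xi> ^ j) \<and>
          (\<lambda>j\<in>{..<d}. real (c j)) \<in> real_box d a b) \<longleftrightarrow> x \<in> ?\<phi> ` B" for x
    proof
      assume "\<exists>c. (\<forall>j<d. c j < p) \<and> x = (\<Sum>j<d. of_nat (c j) * \<xi> ^ j) \<and>
          (\<lambda>j\<in>{..<d}. real (c j)) \<in> real_box d a b"
      then obtain c where c: "x = (\<Sum>j<d. of_nat (c j) * \<xi> ^ j)"
        "(\<lambda>j\<in>{..<d}. real (c j)) \<in> real_box d a b" by blast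
      have "restrict c {..<d} \<in> B"
        using c(2) mem by (auto simp: B_def real_box_def PiE_iff)
      moreover have "x = ?\<phi> (restrict c {..<d})"
        by (simp add: c coord_elem_def)
      ultimately show "x \<in> ?\<phi> ` B" by blast
    next
      assume "x \<in> ?\<phi> ` B"
      then obtain c where c: "c \<in> B" "x = ?\<phi> c" by blast
      then have "\<forall>j<d. c j < p" using B by (auto simp: PiE_iff)
      moreover have "(\<lambda>j\<in>{..<d}. real (c j)) \<in> real_box d a b"
        using c(1) mem by (auto simp: B_def real_box_def PiE_iff)
      ultimately show "\<exists>c. (\<forall>j<d. c j < p) \<and> x = (\<Sum>j<d. of_nat (c j) * \<xi> ^ j) \<and>
          (\<lambda>j\<in>{..<d}. real (c j)) \<in> real_box d a b"
        using c(2) by (auto simp: coord_elem_def)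
    qed
    \<comment> \<open>Elements of the box are nonzero, so a root \<open>y\<close> cannot be 0 and
      being an \<open>m\<close>th power means lying in \<open>?H\<close>.\<close>
    have "x \<in> F \<and> (\<exists>y\<in>F. x = y ^ m) \<longleftrightarrow> x \<in> ?H" if "x \<in> ?\<phi> ` B" for x
    proof -
      have x: "x \<in> F" "x \<noteq> 0" using that \<phi>B by auto
      have "x \<in> ?H" if "y \<in> F" "x = y ^ m" for y
        using that x(2) \<open>m > 1\<close> by (cases "y = 0") (auto simp: nonzero_powers_def)
      moreover have "\<exists>y\<in>F. x = y ^ m" if "x \<in> ?H"
        using that by (auto simp: nonzero_powers_def)
      ultimately show ?thesis using x(1) by metis
    qed
    then have "{x \<in> F. (\<exists>y\<in>F. x = y ^ m) \<and> x \<in> ?\<phi> ` B} = ?\<phi> ` B \<inter> ?H"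
      unfolding set_eq_iff Int_iff mem_Collect_eq by metis
    then show ?thesis
      by (simp only: power_count_def box flip: F_def)
  qed
  have injB: "inj_on ?\<phi> B" using inj B by (rule inj_on_subset)
  have "(\<Sum>x\<in>?\<phi> ` B. power_deviation F m x) = (\<Sum>x\<in>?\<phi> ` B. of_bool (x \<in> ?H) - 1 / real m)"
    using \<phi>B by (intro sum.cong) (auto simp: power_deviation_def)
  also have "\<dots> = real (card (?\<phi> ` B \<inter> ?H)) - real (card B) / real m"
    using finB injB by (simp add: sum_subtractf card_image)
  also have "real (card B) = (\<Prod>j<d. real_of_int (\<lfloor>b j\<rfloor> - \<lceil>a j\<rceil> + 1))"
    unfolding B_def using ul by (simp add: card_PiE)
  finally have "\<bar>real (power_count p d m \<xi> (real_box d a b))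
            - (\<Prod>j<d. real_of_int (\<lfloor>b j\<rfloor> - \<lceil>a j\<rceil> + 1)) / real m\<bar>
      = norm (\<Sum>x\<in>?\<phi> ` B. complex_of_real (power_deviation F m x))"
    by (simp only: count norm_of_real flip: of_real_sum)
  also have "\<dots> \<le> sqrt (real (card F)) * (\<Prod>j<d. interval_dft_norm p (l j) (u j))"
    unfolding B_def using assms(2,4) u_le
    by (intro norm_sum_box_le norm_power_deviation_character_sum_le subfield finite_F) (auto simp: card_F)
  also have "\<dots> \<le> sqrt (real (card F)) * (\<Prod>j<d. 2 / pi * ln (3 * real p ^ d + 1))"
  proof (intro mult_left_mono prod_mono conjI)
    fix j assume "j \<in> {..<d}"
    \<comment> \<open>The strict bound comes from \<open>l j > 0\<close>; it supplies the lengths at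
      most 1 for \<open>p = 2\<close> and at most 2 for \<open>p = 3\<close> in the numerical
      estimate.\<close>
    then have "u j - l j < p" using l_pos[of j] u_le[of j] p_pos by auto
    then show "interval_dft_norm p (l j) (u j) \<le> 2 / pi * ln (3 * real p ^ d + 1)"
      by (rule interval_dft_norm_prime_le[OF p \<open>d > 1\<close>])
    show "0 \<le> interval_dft_norm p (l j) (u j)"
      by (simp add: interval_dft_norm_def sum_nonneg)
  qed simp
  \<comment> \<open>One factor \<open>sqrt p\<close> of \<open>sqrt (p ^ d)\<close> goes to each of
    the \<open>d\<close> coordinates.\<close>
  also have "\<dots> = (2 / pi * sqrt (real p) * ln (3 * real p ^ d + 1)) ^ d"
    by (simp add: card_F real_sqrt_power power_mult_distrib power_divide)
  also have "\<dots> \<le> \<dots> + 2 * real d / real m * real p powr (real d / 2)"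
    by simp
  finally show ?thesis .
qed

end
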